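(* Let $d\ge 2$ be an integer and let $\Gamma$ be a set of $d+4$ points in general position in $\mathbb{P}^d$. Fix a subset $U\subset\Gamma$ consisting of $d-1$ of the points. For each $p\in U$, let $\pi_p:\mathbb{P}^d\dashrightarrow\mathbb{P}^2$ be the projection from the linear span of $U\setminus\{p\}$. Then the points of $\Gamma$ lie on a rational normal curve of degree $d$ in $\mathbb{P}^d$ if and only if, for every $p\in U$, the six points of $\mathbb{P}^2$ given by $\pi_p(p)$ and $\pi_p(q)$ for $q\in\Gamma\setminus U$ lie on a conic.
   Context: Work over the complex numbers. Points in $\mathbb{P}^d$ are in general position if any $d+1$ of them span $\mathbb{P}^d$ (in particular they are distinct). A rational normal curve of degree $d$ in $\mathbb{P}^d$ is a curve projectively equivalent to the image of $\mathbb{P}^1\to\mathbb{P}^d$, $[s:t]\mapsto[s^d:s^{d-1}t:\cdots:t^d]$. A conic in $\mathbb{P}^2$ is the zero locus of a nonzero homogeneous quadratic polynomial. Projection from the span of an empty set is the identity. *)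

theory Defs
  imports "HOL-Analysis.Analysis"
begin

text \<open>
  Projective space of dimension \<open>CARD('n) - 1\<close>: a point is a line through the origin
  of \<open>complex ^ 'n\<close>, represented as the set of its vectors.
\<close>

definition proj_space :: "(complex ^ 'n) set set" where
  "proj_space = {vec.span {v} |v. v \<noteq> 0}"

text \<open>Linear subspaces of projective space are represented by their affine cones.\<close>

definition proj_span :: "(complex ^ 'n) set set \<Rightarrow> (complex ^ 'n) set" where
  "proj_span S = vec.span (\<Union>S)"

definition general_position :: "(complex ^ 'n) set set \<Rightarrow> bool" where
  "general_position \<Gamma> \<longleftrightarrow> (\<forall>S\<subseteq>\<Gamma>. card S = CARD('n) \<longrightarrow> proj_span S = UNIV)"

text \<open>
  The (partial) map of projective spaces induced by a matrix. It is meaningful at the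
  points that are not contained in the kernel; the others are sent to \<open>{0}\<close>, which is not a point.
\<close>

definition proj_map :: "complex ^ 'n ^ 'm \<Rightarrow> (complex ^ 'n) set \<Rightarrow> (complex ^ 'm) set" where
  "proj_map M L = (\<lambda>v. M *v v) ` L"

text \<open>
  A projection with center \<open>\<Lambda>\<close> is determined only up to a projective transformation of its target:
  it is induced by any surjective linear map with kernel \<open>\<Lambda>\<close>.
\<close>

definition projection_from ::
  "(complex ^ 'n) set \<Rightarrow> ((complex ^ 'n) set \<Rightarrow> (complex ^ 'm) set) \<Rightarrow> bool" where
  "projection_from \<Lambda> \<pi> \<longleftrightarrow>
     (\<exists>M :: complex ^ 'n ^ 'm.
        surj (\<lambda>v. M *v v) \<and> {v. M *v v = 0} = \<Lambda> \<and> \<pi> = proj_map M)"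

lemma projection_from_empty: "projection_from (proj_span {}) (\<lambda>L. L)"
  unfolding projection_from_def proj_span_def proj_map_def
  by (rule exI[of _ "mat 1"]) auto

text \<open>
  The function \<open>to_nat_on UNIV\<close> is a bijection from the finite index type \<open>'n\<close> to
  \<open>{..<CARD('n)}\<close>; it numbers the homogeneous coordinates as \<open>0, ..., d\<close>, where \<open>d = CARD('n) - 1\<close>.
\<close>

definition veronese :: "complex \<Rightarrow> complex \<Rightarrow> complex ^ 'n" where
  "veronese s t =
     (\<chi> i. s ^ (CARD('n) - 1 - to_nat_on (UNIV :: 'n set) i) * t ^ to_nat_on (UNIV :: 'n set) i)"

definition standard_rational_normal_curve :: "(complex ^ 'n) set set" where
  "standard_rational_normal_curve = {vec.span {veronese s t} |s t. (s, t) \<noteq> (0, 0)}"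

definition rational_normal_curve :: "(complex ^ 'n) set set \<Rightarrow> bool" where
  "rational_normal_curve C \<longleftrightarrow>
     (\<exists>A :: complex ^ 'n ^ 'n. invertible A \<and> C = proj_map A ` standard_rational_normal_curve)"

definition plane_conic :: "(complex ^ 3) set set \<Rightarrow> bool" where
  "plane_conic C \<longleftrightarrow>
     (\<exists>a b c d e f. (a, b, c, d, e, f) \<noteq> (0, 0, 0, 0, 0, 0) \<and>
        C = {L \<in> proj_space. \<forall>x\<in>L.
               a * (x $ 1)\<^sup>2 + b * (x $ 2)\<^sup>2 + c * (x $ 3)\<^sup>2
               + d * (x $ 1 * x $ 2) + e * (x $ 1 * x $ 3) + f * (x $ 2 * x $ 3) = 0})"

end

theory Submission
  imports Defs
begin

text \<open>
  If the points lie on a rational normal curve parametrised by binary forms of degree \<open>d\<close>, the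
  coordinates of its projection from \<open>U - {p}\<close> vanish at the \<open>d - 2\<close> parameters of \<open>U - {p}\<close>.
  After cancelling the common factor the image is parametrised by three binary quadratic forms. Their
  six products of degree 2 lie in the 5-dimensional space of binary quartic forms and are therefore
  linearly dependent, which gives the conic.

  Conversely, choose \<open>U\<close> and two further points as coordinate points; the remaining three
  points then have nonzero coordinates \<open>x\<^sub>i\<close>. The Cremona transformation \<open>y\<^sub>i = 1 / x\<^sub>i\<close> turns the
  conic belonging to \<open>p \<in> U\<close> into a line and thus expresses the coordinate \<open>y\<^sub>p\<close> as a linear form in
  the two coordinates \<open>(s, t)\<close> of \<open>y\<close> belonging to the two further points. If \<open>\<ell>\<^sub>i (s, t)\<close> are
  these linear forms, the curve with coordinates \<open>\<Prod>\<^bsub>j \<noteq> i\<^esub> \<ell>\<^sub>j (s, t)\<close> is a rational normal curve through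
  all the points: it passes through the \<open>i\<close>-th coordinate point at the zero of \<open>\<ell>\<^sub>i\<close>.
\<close>

subsection \<open>Binary forms\<close>

text \<open>Forms are functions of two variables and can be evaluated at a parameter directly. The
  zero function is a form of every degree, so the forms of a fixed degree are closed under linear
  combinations.\<close>

definition binary_form :: "nat \<Rightarrow> (complex \<Rightarrow> complex \<Rightarrow> complex) \<Rightarrow> bool" where
  "binary_form d f \<longleftrightarrow> (\<exists>a. \<forall>s t. f s t = (\<Sum>k\<le>d. a k * s ^ (d - k) * t ^ k))"

lemma binary_form_zero: "binary_form d (\<lambda>s t. 0)"
  unfolding binary_form_def by (rule exI[of _ "\<lambda>_. 0"]) simp

lemma binary_form_add:
  assumes "binary_form d f" "binary_form d g"
  shows "binary_form d (\<lambda>s t. f s t + g s t)"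
proof -
  obtain a b where "\<And>s t. f s t = (\<Sum>k\<le>d. a k * s ^ (d - k) * t ^ k)"
    "\<And>s t. g s t = (\<Sum>k\<le>d. b k * s ^ (d - k) * t ^ k)"
    using assms unfolding binary_form_def by blast
  then show ?thesis
    unfolding binary_form_def
    by (intro exI[of _ "\<lambda>k. a k + b k"]) (simp add: sum.distrib distrib_right)
qed

lemma binary_form_cmult:
  assumes "binary_form d f"
  shows "binary_form d (\<lambda>s t. c * f s t)"
proof -
  obtain a where "\<And>s t. f s t = (\<Sum>k\<le>d. a k * s ^ (d - k) * t ^ k)"
    using assms unfolding binary_form_def by blast
  then show ?thesis
    unfolding binary_form_def
    by (intro exI[of _ "\<lambda>k. c * a k"]) (simp add: sum_distrib_left mult.assoc)
qed

lemma binary_form_sum: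
  assumes "\<And>i. i \<in> I \<Longrightarrow> binary_form d (f i)"
  shows "binary_form d (\<lambda>s t. \<Sum>i\<in>I. f i s t)"
  using assms
  by (induction I rule: infinite_finite_induct)
    (auto intro: binary_form_zero binary_form_add)

lemma binary_form_monom:
  assumes "i + j = d"
  shows "binary_form d (\<lambda>s t. s ^ i * t ^ j)"
proof -
  have "s ^ i * t ^ j = (\<Sum>k\<le>d. (if k = j then 1 else 0) * s ^ (d - k) * t ^ k)" for s t :: complex
  proof -
    have "(\<Sum>k\<le>d. (if k = j then 1 else 0) * s ^ (d - k) * t ^ k)
        = (\<Sum>k\<le>d. if k = j then s ^ (d - k) * t ^ k else 0)"
      by (intro sum.cong) auto
    then show ?thesis
      using assms by auto
  qed
  then show ?thesis
    unfolding binary_form_def by (intro exI[of _ "\<lambda>k. if k = j then 1 else 0"] allI)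
qed

lemma binary_form_mult:
  assumes "binary_form d f" "binary_form e g"
  shows "binary_form (d + e) (\<lambda>s t. f s t * g s t)"
proof -
  obtain a b where a: "\<And>s t. f s t = (\<Sum>k\<le>d. a k * s ^ (d - k) * t ^ k)"
    and b: "\<And>s t. g s t = (\<Sum>k\<le>e. b k * s ^ (e - k) * t ^ k)"
    using assms unfolding binary_form_def by blast
  have "f s t * g s t =
      (\<Sum>k\<le>d. \<Sum>l\<le>e. (a k * b l) * (s ^ ((d - k) + (e - l)) * t ^ (k + l)))" for s t
    unfolding a b sum_product by (intro sum.cong refl) (simp only: power_add mult_ac)
  moreover have "binary_form (d + e)
      (\<lambda>s t. \<Sum>k\<le>d. \<Sum>l\<le>e. (a k * b l) * (s ^ ((d - k) + (e - l)) * t ^ (k + l)))"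
    by (intro binary_form_sum binary_form_cmult binary_form_monom) auto
  ultimately show ?thesis
    by simp
qed

lemma binary_form_linear: "binary_form 1 (\<lambda>s t. a * s + b * t)"
  using binary_form_add[OF binary_form_cmult[OF binary_form_monom[of 1 0 1], of a]
      binary_form_cmult[OF binary_form_monom[of 0 1 1], of b]]
  by simp

lemma binary_form_prod_linear:
  assumes "finite I"
  shows "binary_form (card I) (\<lambda>s t. \<Prod>i\<in>I. a i * s + b i * t)"
  using assms
proof (induction I rule: finite_induct)
  case empty
  show ?case
    using binary_form_monom[of 0 0 0] by simp
next
  case (insert i I)
  then show ?case
    using binary_form_mult[OF binary_form_linear[of "a i" "b i"] insert.IH] by simp
qed

lemma binary_form_swap:
  assumes "binary_form d f"
  shows "binary_form d (\<lambda>s t. f t s)"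
proof -
  obtain a where a: "\<And>s t. f s t = (\<Sum>k\<le>d. a k * s ^ (d - k) * t ^ k)"
    using assms unfolding binary_form_def by blast
  have "binary_form d (\<lambda>s t. \<Sum>k\<le>d. a k * (s ^ k * t ^ (d - k)))"
    by (intro binary_form_sum binary_form_cmult binary_form_monom) auto
  then show ?thesis
    unfolding a by (simp add: mult_ac)
qed

section \<open>Splitting off linear factors at zeros\<close>

lemma binary_form_factor_nonzero:
  assumes f: "binary_form (Suc d) f" and zero: "f s0 t0 = 0" and t0: "t0 \<noteq> 0"
  shows "\<exists>g. binary_form d g \<and> (\<forall>s t. f s t = (t0 * s - s0 * t) * g s t)"
proof -
  obtain a where a: "\<And>s t. f s t = (\<Sum>k\<le>Suc d. a k * s ^ (Suc d - k) * t ^ k)"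
    using f unfolding binary_form_def by blast
  \<comment> \<open>\<open>h\<close> sums, over \<open>k\<close>, the quotient of the
    \<open>k\<close>-th difference of monomials by \<open>t0 * s - s0 * t\<close>. The difference
    for \<open>k = Suc d\<close> is 0, so \<open>k\<close> stops at \<open>d\<close>.\<close>
  define h where "h = (\<lambda>s t. \<Sum>k\<le>d. \<Sum>i<Suc d - k.
    (a k * t0 ^ k * t0 ^ i * s0 ^ (d - k - i)) * (s ^ i * t ^ (d - k - i + k)))"
  have h: "binary_form d h"
    unfolding h_def by (intro binary_form_sum binary_form_cmult binary_form_monom) auto
  \<comment> \<open>\<open>f (t0 s, t0 t)\<close> is compared with \<open>f (s0 t, t0 t) = t\<^sup>d\<^sup>+\<^sup>1 f (s0, t0) = 0\<close> monomial by monomial.\<close>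
  have key: "t0 ^ Suc d * f s t = (t0 * s - s0 * t) * h s t" for s t
  proof -
    have "t0 ^ Suc d * f s t = (\<Sum>k\<le>Suc d. a k * (t0 * t) ^ k * (t0 * s) ^ (Suc d - k))"
      unfolding a sum_distrib_left
    proof (intro sum.cong refl)
      fix k assume "k \<in> {..Suc d}"
      then have "t0 ^ Suc d = t0 ^ k * t0 ^ (Suc d - k)"
        by (metis atMost_iff le_add_diff_inverse power_add)
      then show "t0 ^ Suc d * (a k * s ^ (Suc d - k) * t ^ k)
          = a k * (t0 * t) ^ k * (t0 * s) ^ (Suc d - k)"
        by (simp add: power_mult_distrib mult_ac del: power_Suc)
    qed
    moreover have "0 = (\<Sum>k\<le>Suc d. a k * (t0 * t) ^ k * (s0 * t) ^ (Suc d - k))"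
    proof -
      have "0 = t ^ Suc d * f s0 t0"
        by (simp add: zero)
      also have "\<dots> = (\<Sum>k\<le>Suc d. a k * (t0 * t) ^ k * (s0 * t) ^ (Suc d - k))"
        unfolding a sum_distrib_left
      proof (intro sum.cong refl)
        fix k assume "k \<in> {..Suc d}"
        then have "t ^ Suc d = t ^ k * t ^ (Suc d - k)"
          by (metis atMost_iff le_add_diff_inverse power_add)
        then show "t ^ Suc d * (a k * s0 ^ (Suc d - k) * t0 ^ k)
            = a k * (t0 * t) ^ k * (s0 * t) ^ (Suc d - k)"
          by (simp add: power_mult_distrib mult_ac del: power_Suc)
      qed
      finally show ?thesis .
    qed
    ultimately have "t0 ^ Suc d * f s t = (\<Sum>k\<le>Suc d. a k * (t0 * t) ^ k *
        ((t0 * s) ^ (Suc d - k) - (s0 * t) ^ (Suc d - k)))"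
      by (simp add: right_diff_distrib sum_subtractf del: sum.atMost_Suc)
    also have "\<dots> = (\<Sum>k\<le>d. a k * (t0 * t) ^ k *
        ((t0 * s) ^ (Suc d - k) - (s0 * t) ^ (Suc d - k)))"
      by simp
    also have "\<dots> = (t0 * s - s0 * t) * h s t"
      unfolding h_def sum_distrib_left
    proof (intro sum.cong refl)
      fix k assume "k \<in> {..d}"
      then have k: "Suc d - k = Suc (d - k)"
        by auto
      have "a k * (t0 * t) ^ k * ((t0 * s) ^ (Suc d - k) - (s0 * t) ^ (Suc d - k))
          = a k * (t0 * t) ^ k * ((t0 * s - s0 * t) *
              (\<Sum>i<Suc (d - k). (t0 * s) ^ i * (s0 * t) ^ (d - k - i)))"
        unfolding k diff_power_eq_sum by (simp only: mult_ac)
      also have "\<dots> = (\<Sum>i<Suc d - k. (t0 * s - s0 * t) *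
          (a k * t0 ^ k * t0 ^ i * s0 ^ (d - k - i) * (s ^ i * t ^ (d - k - i + k))))"
        unfolding k sum_distrib_left
        by (intro sum.cong refl) (simp add: power_mult_distrib power_add mult_ac)
      finally show "a k * (t0 * t) ^ k * ((t0 * s) ^ (Suc d - k) - (s0 * t) ^ (Suc d - k))
          = (\<Sum>i<Suc d - k. (t0 * s - s0 * t) *
          (a k * t0 ^ k * t0 ^ i * s0 ^ (d - k - i) * (s ^ i * t ^ (d - k - i + k))))" .
    qed
    finally show ?thesis .
  qed
  show ?thesis
  proof (intro exI conjI allI)
    show "binary_form d (\<lambda>s t. inverse (t0 ^ Suc d) * h s t)"
      by (rule binary_form_cmult[OF h])
    show "f s t = (t0 * s - s0 * t) * (inverse (t0 ^ Suc d) * h s t)" for s t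
      using key[of s t] t0 by (simp add: field_simps)
  qed
qed

text \<open>A zero with \<open>t0 = 0\<close> has \<open>s0\<close> nonzero, so exchanging the
  variables reduces it to the previous case. The exchange reverses the sign of the linear factor,
  whence the factor -1.\<close>

lemma binary_form_factor:
  assumes f: "binary_form (Suc d) f" and zero: "f s0 t0 = 0" and nz: "(s0, t0) \<noteq> (0, 0)"
  shows "\<exists>g. binary_form d g \<and> (\<forall>s t. f s t = (t0 * s - s0 * t) * g s t)"
proof (cases "t0 = 0")
  case False
  then show ?thesis
    by (rule binary_form_factor_nonzero[OF f zero])
next
  case True
  with nz have "s0 \<noteq> 0"
    by simp
  then have "\<exists>g. binary_form d g \<and> (\<forall>s t. f t s = (s0 * s - t0 * t) * g s t)"
    by (rule binary_form_factor_nonzero[OF binary_form_swap[OF f] zero])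
  then obtain g where g: "binary_form d g" "\<And>s t. f t s = (s0 * s - t0 * t) * g s t"
    by blast
  have "binary_form d (\<lambda>s t. (-1) * g t s)"
    by (rule binary_form_cmult[OF binary_form_swap[OF g(1)]])
  moreover have "f s t = (t0 * s - s0 * t) * ((-1) * g t s)" for s t
    unfolding g(2) by (simp add: algebra_simps)
  ultimately show ?thesis
    by (intro exI[of _ "\<lambda>s t. (-1) * g t s"] conjI allI)
qed

text \<open>The last hypothesis says that the zeros are distinct points of the projective line.
  Hence the factors already split off do not vanish at a further zero, and the cofactor must vanish
  there.\<close>

lemma binary_form_factor_prod:
  assumes "finite I" and "binary_form d f" and "card I \<le> d"
    and "\<And>i. i \<in> I \<Longrightarrow> f (\<sigma> i) (\<tau> i) = 0"
    and "\<And>i. i \<in> I \<Longrightarrow> (\<sigma> i, \<tau> i) \<noteq> (0, 0)"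
    and "\<And>i j. i \<in> I \<Longrightarrow> j \<in> I \<Longrightarrow> i \<noteq> j \<Longrightarrow> \<tau> i * \<sigma> j \<noteq> \<sigma> i * \<tau> j"
  shows "\<exists>g. binary_form (d - card I) g \<and> (\<forall>s t. f s t = (\<Prod>i\<in>I. \<tau> i * s - \<sigma> i * t) * g s t)"
  using assms
proof (induction I rule: finite_induct)
  case empty
  then show ?case
    by (intro exI[of _ f]) simp
next
  case (insert j I)
  have "\<exists>g. binary_form (d - card I) g \<and> (\<forall>s t. f s t = (\<Prod>i\<in>I. \<tau> i * s - \<sigma> i * t) * g s t)"
    using insert.prems insert.hyps by (intro insert.IH) auto
  then obtain g where g: "binary_form (d - card I) g"
      "\<And>s t. f s t = (\<Prod>i\<in>I. \<tau> i * s - \<sigma> i * t) * g s t"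
    by blast
  have "(\<Prod>i\<in>I. \<tau> i * \<sigma> j - \<sigma> i * \<tau> j) \<noteq> 0"
    using insert.prems(5)[of _ j] insert.hyps by force
  then have "g (\<sigma> j) (\<tau> j) = 0"
    using g(2)[of "\<sigma> j" "\<tau> j"] insert.prems(3)[of j] by simp
  moreover have d: "d - card I = Suc (d - card (insert j I))"
    using insert.prems(2) insert.hyps by simp
  ultimately obtain h where h: "binary_form (d - card (insert j I)) h"
      "\<And>s t. g s t = (\<tau> j * s - \<sigma> j * t) * h s t"
    using binary_form_factor[OF g(1)[unfolded d] _ insert.prems(4)[OF insertI1]] by blast
  have "f s t = (\<Prod>i\<in>insert j I. \<tau> i * s - \<sigma> i * t) * h s t" for s t
    unfolding g(2) h(2) prod.insert[OF insert.hyps] by (simp only: mult_ac)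
  with h(1) show ?case
    by (intro exI[of _ h] conjI allI)
qed

section \<open>Binary forms as linear forms on the Veronese curve\<close>

lemma bij_betw_to_nat_on_UNIV: "bij_betw (to_nat_on (UNIV :: 'n::finite set)) UNIV {..<CARD('n)}"
  using to_nat_on_finite[of "UNIV :: 'n set"] by simp

lemma sum_to_nat_on_UNIV:
  "(\<Sum>i\<in>UNIV. h (to_nat_on (UNIV :: 'n::finite set) i)) = (\<Sum>k<CARD('n). h k)"
  by (rule sum.reindex_bij_betw[OF bij_betw_to_nat_on_UNIV])

text \<open>The coordinates of \<open>veronese s t\<close> are the monomials of degree
  \<open>d\<close>. The type \<open>'n\<close> is free, so the equivalence serves both the curves in
  the ambient space and, with \<open>'n = 5\<close>, the coefficient vectors of quartic
  forms.\<close>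

lemma binary_form_iff_veronese:
  assumes "CARD('n::finite) = d + 1"
  shows "binary_form d f \<longleftrightarrow> (\<exists>c :: complex ^ 'n. \<forall>s t. f s t = (\<Sum>i\<in>UNIV. c $ i * veronese s t $ i))"
    (is "?L \<longleftrightarrow> ?R")
proof
  let ?idx = "to_nat_on (UNIV :: 'n set)"
  have card: "{..<CARD('n)} = {..d}" "CARD('n) - 1 = d"
    using assms by auto
  {
    assume ?L
    then obtain a where a: "\<And>s t. f s t = (\<Sum>k\<le>d. a k * s ^ (d - k) * t ^ k)"
      unfolding binary_form_def by blast
    have "f s t = (\<Sum>i\<in>UNIV. (\<chi> i. a (?idx i)) $ i * veronese s t $ i)" for s t
      using sum_to_nat_on_UNIV[where 'n = 'n, of "\<lambda>k. a k * s ^ (d - k) * t ^ k"]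
      unfolding a card veronese_def by (simp only: mult.assoc vec_lambda_beta)
    then show ?R
      by (intro exI[of _ "\<chi> i. a (?idx i)"] allI)
  }
  {
    assume ?R
    then obtain c :: "complex ^ 'n" where c: "\<And>s t. f s t = (\<Sum>i\<in>UNIV. c $ i * veronese s t $ i)"
      by blast
    have "?idx i \<le> d" for i
      using bij_betw_apply[OF bij_betw_to_nat_on_UNIV, of i] assms by simp
    then have "binary_form d (\<lambda>s t. \<Sum>i\<in>UNIV. c $ i * (s ^ (d - ?idx i) * t ^ ?idx i))"
      by (intro binary_form_sum binary_form_cmult binary_form_monom) auto
    then show ?L
      unfolding c veronese_def card by simp
  }
qed

subsection \<open>Projections of rational normal curves\<close>

lemma span_singleton_scale:
  fixes v :: "complex ^ 'n"
  assumes "c \<noteq> 0"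
  shows "vec.span {c *s v} = vec.span {v}"
proof -
  have "c *s v \<in> vec.span {v}"
    by (intro vec.span_scale vec.span_base) simp
  moreover have "inverse c *s (c *s v) \<in> vec.span {c *s v}"
    by (intro vec.span_scale vec.span_base) simp
  ultimately show ?thesis
    unfolding vec.span_eq using assms by (simp add: vector_smult_assoc)
qed

lemma proj_map_span: "proj_map M (vec.span {v}) = vec.span {M *v v}"
  unfolding proj_map_def vec.span_singleton image_image vector_scalar_commute ..

abbreviation quadric :: "complex \<Rightarrow> complex \<Rightarrow> complex \<Rightarrow> complex \<Rightarrow> complex \<Rightarrow> complex
    \<Rightarrow> complex \<Rightarrow> complex \<Rightarrow> complex \<Rightarrow> complex" where
  "quadric a b c d e f x y z \<equiv>
     a * x\<^sup>2 + b * y\<^sup>2 + c * z\<^sup>2 + d * (x * y) + e * (x * z) + f * (y * z)"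

lemma quadric_scale: "quadric a b c d e f (k * x) (k * y) (k * z) = k\<^sup>2 * quadric a b c d e f x y z"
  unfolding power_mult_distrib by (simp add: power2_eq_square algebra_simps)

text \<open>By homogeneity, vanishing at one nonzero representative is vanishing on the whole
  line.\<close>

lemma span_mem_conic_iff:
  fixes v :: "complex ^ 3"
  assumes "v \<noteq> 0"
  shows "vec.span {v} \<in> {L \<in> proj_space. \<forall>x\<in>L.
      quadric a b c d e f (x $ 1) (x $ 2) (x $ 3) = 0}
    \<longleftrightarrow> quadric a b c d e f (v $ 1) (v $ 2) (v $ 3) = 0"
proof -
  have "vec.span {v} \<in> proj_space"
    using assms unfolding proj_space_def by blast
  moreover have "quadric a b c d e f ((k *s v) $ 1) ((k *s v) $ 2) ((k *s v) $ 3)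
      = k\<^sup>2 * quadric a b c d e f (v $ 1) (v $ 2) (v $ 3)" for k
    using quadric_scale by simp
  ultimately show ?thesis
    unfolding vec.span_singleton
    by (auto dest: spec[of _ 1])
qed

text \<open>Proportional parameters therefore give the same point. The index of a coordinate is at
  most the degree, so the natural subtraction in the exponent is exact.\<close>

lemma veronese_scale:
  shows "(veronese (k * s) (k * t) :: complex ^ 'n) = k ^ (CARD('n) - 1) *s veronese s t"
proof -
  have "to_nat_on (UNIV :: 'n set) i \<le> CARD('n) - 1" for i
    using bij_betw_apply[OF bij_betw_to_nat_on_UNIV, of i] by simp
  then have pow: "k ^ (CARD('n) - 1) = k ^ (CARD('n) - 1 - to_nat_on (UNIV :: 'n set) i)
      * k ^ to_nat_on (UNIV :: 'n set) i" for i
    by (metis le_add_diff_inverse2 power_add)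
  show ?thesis
    unfolding vec_eq_iff veronese_def vec_lambda_beta vector_smult_component
  proof
    fix i
    show "(k * s) ^ (CARD('n) - 1 - to_nat_on (UNIV :: 'n set) i) * (k * t) ^ to_nat_on (UNIV :: 'n set) i
      = k ^ (CARD('n) - 1) *
        (s ^ (CARD('n) - 1 - to_nat_on (UNIV :: 'n set) i) * t ^ to_nat_on (UNIV :: 'n set) i)"
      by (subst pow[of i]) (simp only: power_mult_distrib mult_ac)
  qed
qed

lemma binary_form_matrix_veronese:
  fixes N :: "complex ^ 'n ^ 'm"
  assumes "CARD('n) = d + 1"
  shows "binary_form d (\<lambda>s t. (N *v veronese s t) $ k)"
  unfolding binary_form_iff_veronese[OF assms]
  by (intro exI[of _ "N $ k"]) (simp add: matrix_vector_mult_def)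

text \<open>A quartic form has five coefficients, so six of them form the columns of a matrix with
  five rows, which has a nonzero kernel vector.\<close>

lemma quartic_forms_dependent:
  assumes "\<And>k. k < 6 \<Longrightarrow> binary_form 4 (h k)"
  shows "\<exists>c :: nat \<Rightarrow> complex. (\<exists>k<6. c k \<noteq> 0) \<and> (\<forall>s t. (\<Sum>k<6. c k * h k s t) = 0)"
proof -
  let ?idx = "to_nat_on (UNIV :: 6 set)"
  have idx: "?idx i < 6" for i
    using bij_betwE[OF bij_betw_to_nat_on_UNIV[where 'n = 6]] by simp
  have "\<exists>a :: complex ^ 5. \<forall>s t. h (?idx i) s t = (\<Sum>j\<in>UNIV. a $ j * veronese s t $ j)" for i
    using binary_form_iff_veronese[where 'n = 5 and d = 4] assms[OF idx] by simp
  then obtain a :: "6 \<Rightarrow> complex ^ 5"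
    where a: "\<And>i s t. h (?idx i) s t = (\<Sum>j\<in>UNIV. a i $ j * veronese s t $ j)"
    by metis
  define N :: "complex ^ 6 ^ 5" where "N = (\<chi> j i. a i $ j)"
  have "\<not> inj ((*v) N)"
  proof
    assume inj: "inj ((*v) N)"
    have "vec.dim ((*v) N ` UNIV) = vec.dim (UNIV :: (complex ^ 6) set)"
      by (rule vec.dim_image_eq) (use inj in \<open>auto intro: inj_on_subset\<close>)
    moreover have "vec.dim ((*v) N ` UNIV) \<le> vec.dim (UNIV :: (complex ^ 5) set)"
      by (rule vec.dim_subset) simp
    ultimately have "CARD(6) \<le> CARD(5)"
      unfolding vec_dim_card by simp
    then show False
      by simp
  qed
  then obtain x where x: "N *v x = 0" "x \<noteq> 0"
    unfolding vec.inj_iff_eq_0 by auto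
  obtain i where i: "x $ i \<noteq> 0"
    using x(2) by (auto simp: vec_eq_iff)
  \<comment> \<open>The kernel vector is indexed by the type \<open>6\<close>; \<open>c\<close>
    moves its entries to the numbers below 6.\<close>
  define c where "c k = x $ (inv ?idx k)" for k
  have inj: "inj ?idx"
    using bij_betw_to_nat_on_UNIV[where 'n = 6] by (rule bij_betw_imp_inj_on)
  have c: "c (?idx i) = x $ i" for i
    unfolding c_def using inj by simp
  have "(\<Sum>k<6. c k * h k s t) = 0" for s t
  proof -
    have "(\<Sum>k<6. c k * h k s t) = (\<Sum>i\<in>UNIV. c (?idx i) * h (?idx i) s t)"
      using sum_to_nat_on_UNIV[where 'n = 6, of "\<lambda>k. c k * h k s t"] by simp
    also have "\<dots> = (\<Sum>i\<in>UNIV. \<Sum>j\<in>UNIV. x $ i * (a i $ j * veronese s t $ j))"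
      unfolding a c sum_distrib_left ..
    also have "\<dots> = (\<Sum>j\<in>UNIV. \<Sum>i\<in>UNIV. x $ i * (a i $ j * veronese s t $ j))"
      by (rule sum.swap)
    also have "\<dots> = (\<Sum>j\<in>UNIV. (N *v x) $ j * veronese s t $ j)"
      unfolding N_def matrix_vector_mult_def vec_lambda_beta sum_distrib_right by (simp only: mult_ac)
    finally show ?thesis
      by (simp add: x(1))
  qed
  moreover have "\<exists>k<6. c k \<noteq> 0"
    using c i idx by metis
  ultimately show ?thesis
    by blast
qed

lemma quadratic_forms_on_conic:
  assumes x: "binary_form 2 x" and y: "binary_form 2 y" and z: "binary_form 2 z"
  shows "\<exists>a b c d e f. (a, b, c, d, e, f) \<noteq> (0, 0, 0, 0, 0, 0) \<and>
    (\<forall>s t. quadric a b c d e f (x s t) (y s t) (z s t) = 0)"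
proof -
  \<comment> \<open>The products are listed in the order in which \<open>quadric\<close> takes its
    coefficients.\<close>
  define h where "h = (!) [\<lambda>s t. x s t * x s t, \<lambda>s t. y s t * y s t, \<lambda>s t. z s t * z s t,
    \<lambda>s t. x s t * y s t, \<lambda>s t. x s t * z s t, \<lambda>s t. y s t * z s t]"
  have "binary_form 4 (h k)" if "k < 6" for k
  proof -
    have "k \<in> {0, 1, 2, 3, 4, 5}"
      using that by auto
    moreover have "binary_form 4 (\<lambda>s t. f s t * g s t)" if "binary_form 2 f" "binary_form 2 g" for f g
      using binary_form_mult[OF that] by simp
    note this[OF x x] this[OF y y] this[OF z z] this[OF x y] this[OF x z] this[OF y z]
    ultimately show ?thesis
      unfolding h_def by (elim insertE emptyE; simp)
  qed
  then obtain c where c: "\<exists>k<6. c k \<noteq> 0" "\<And>s t. (\<Sum>k<6. c k * h k s t) = 0"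
    using quartic_forms_dependent[of h] by blast
  have "quadric (c 0) (c 1) (c 2) (c 3) (c 4) (c 5) (x s t) (y s t) (z s t) = 0" for s t
    using c(2)[of s t] unfolding h_def by (simp add: eval_nat_numeral)
  moreover have "(c 0, c 1, c 2, c 3, c 4, c 5) \<noteq> (0, 0, 0, 0, 0, 0)"
    using c(1) by (auto simp: less_Suc_eq eval_nat_numeral)
  ultimately show ?thesis
    by (intro exI conjI allI)
qed

text \<open>\<open>I\<close> stands for \<open>U - {p}\<close>: its points lie in the centre, which
  gives each coordinate of the projected curve \<open>d - 2\<close> known zeros. The three
  coordinates share the product of the linear factors, which drops out of the conic equation by
  homogeneity.\<close>

lemma plane_conic_of_rational_normal_curve:
  fixes C :: "(complex ^ 'n) set set" and M :: "complex ^ 'n ^ 3"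
  assumes d: "d \<ge> 2" "CARD('n) = d + 1"
    and C: "rational_normal_curve C"
    and I: "I \<subseteq> C" "finite I" "card I = d - 2" "\<And>L. L \<in> I \<Longrightarrow> proj_map M L = {0}"
  shows "\<exists>D. plane_conic D \<and> (\<forall>L\<in>C. proj_map M L \<noteq> {0} \<longrightarrow> proj_map M L \<in> D)"
proof -
  obtain A :: "complex ^ 'n ^ 'n" where A: "C = proj_map A ` standard_rational_normal_curve"
    using C unfolding rational_normal_curve_def by blast
  have "\<exists>s t. (s, t) \<noteq> (0, 0) \<and> L = vec.span {A *v veronese s t}" if "L \<in> C" for L
    using that unfolding A standard_rational_normal_curve_def
    using proj_map_span[of A] by (smt (verit, best) image_iff mem_Collect_eq)
  then have "\<forall>L\<in>C. \<exists>st. st \<noteq> (0, 0) \<and> L = vec.span {A *v veronese (fst st) (snd st)}"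
    by fastforce
  then obtain st where st: "\<forall>L\<in>C. st L \<noteq> (0, 0) \<and> L = vec.span {A *v veronese (fst (st L)) (snd (st L))}"
    by (rule bchoice[THEN exE])
  define \<sigma> \<tau> where "\<sigma> L = fst (st L)" and "\<tau> L = snd (st L)" for L
  have nz: "(\<sigma> L, \<tau> L) \<noteq> (0, 0)" and L: "L = vec.span {A *v veronese (\<sigma> L) (\<tau> L)}"
    if "L \<in> C" for L
    using st that unfolding \<sigma>_def \<tau>_def by auto
  \<comment> \<open>Equality would make the two parameters proportional, so that they would give the
    same point of the curve.\<close>
  have neq: "\<tau> L * \<sigma> L' \<noteq> \<sigma> L * \<tau> L'" if LL: "L \<in> C" "L' \<in> C" "L \<noteq> L'" for L L'
  proof
    assume eq: "\<tau> L * \<sigma> L' = \<sigma> L * \<tau> L'"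
    \<comment> \<open>The ratio is read off from a coordinate in which the first parameter is
      nonzero.\<close>
    obtain k where k: "k \<noteq> 0" "\<sigma> L' = k * \<sigma> L" "\<tau> L' = k * \<tau> L"
    proof (cases "\<sigma> L = 0")
      case True
      then show ?thesis
        using that[of "\<tau> L' / \<tau> L"] nz[OF LL(1)] nz[OF LL(2)] eq by auto
    next
      case False
      then have "\<sigma> L' \<noteq> 0"
        using nz[OF LL(2)] eq by auto
      with False show ?thesis
        using that[of "\<sigma> L' / \<sigma> L"] eq by (simp add: field_simps)
    qed
    have "A *v veronese (\<sigma> L') (\<tau> L') = k ^ d *s (A *v veronese (\<sigma> L) (\<tau> L))"
      unfolding k veronese_scale using d by (simp add: vector_scalar_commute)
    then have "vec.span {A *v veronese (\<sigma> L') (\<tau> L')} = vec.span {A *v veronese (\<sigma> L) (\<tau> L)}"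
      by (simp add: span_singleton_scale k(1))
    with L[OF LL(1)] L[OF LL(2)] LL(3) show False
      by metis
  qed
  \<comment> \<open>These are the coordinates of the projected curve, as forms in its
    parameter.\<close>
  define g where "g k s t = (M *v (A *v veronese s t)) $ k" for k s t
  have form: "binary_form d (g k)" for k
    unfolding g_def using binary_form_matrix_veronese[OF d(2), of "M ** A"]
    by (simp add: matrix_vector_mul_assoc)
  have zero: "g k (\<sigma> L) (\<tau> L) = 0" if "L \<in> I" for k L
  proof -
    have "L \<in> C"
      using that I(1) by blast
    have "vec.span {M *v (A *v veronese (\<sigma> L) (\<tau> L))} = proj_map M L"
      using arg_cong[OF L[OF \<open>L \<in> C\<close>], of "proj_map M"] unfolding proj_map_span by (rule sym)
    also have "\<dots> = {0}"
      by (rule I(4)[OF that])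
    finally have "vec.span {M *v (A *v veronese (\<sigma> L) (\<tau> L))} = {0}" .
    then have "M *v (A *v veronese (\<sigma> L) (\<tau> L)) = 0"
      using vec.span_base[of _ "{M *v (A *v veronese (\<sigma> L) (\<tau> L))}"] by auto
    then show ?thesis
      unfolding g_def by simp
  qed
  have "d - card I = 2"
    using I d by simp
  moreover have "\<exists>q. binary_form (d - card I) q \<and>
      (\<forall>s t. g k s t = (\<Prod>L\<in>I. \<tau> L * s - \<sigma> L * t) * q s t)" for k
  proof (rule binary_form_factor_prod)
    show "\<tau> L * \<sigma> L' \<noteq> \<sigma> L * \<tau> L'" if "L \<in> I" "L' \<in> I" "L \<noteq> L'" for L L'
      using neq[of L L'] that I(1) by blast
    show "(\<sigma> L, \<tau> L) \<noteq> (0, 0)" if "L \<in> I" for L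
      using nz[of L] that I(1) by blast
  qed (use I form zero in auto)
  ultimately have "\<forall>k. \<exists>q. binary_form 2 q \<and>
      (\<forall>s t. g k s t = (\<Prod>L\<in>I. \<tau> L * s - \<sigma> L * t) * q s t)"
    by simp
  then obtain q where q: "\<And>k. binary_form 2 (q k)"
      "\<And>k s t. g k s t = (\<Prod>L\<in>I. \<tau> L * s - \<sigma> L * t) * q k s t"
    using choice[of "\<lambda>k q. binary_form 2 q \<and> (\<forall>s t. g k s t = (\<Prod>L\<in>I. \<tau> L * s - \<sigma> L * t) * q s t)"]
    by blast
  obtain a b c d e f where conic: "(a, b, c, d, e, f) \<noteq> (0, 0, 0, 0, 0, 0)"
      "\<And>s t. quadric a b c d e f (q 1 s t) (q 2 s t) (q 3 s t) = 0"
    using quadratic_forms_on_conic[OF q(1)[of 1] q(1)[of 2] q(1)[of 3]] by blast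
  have g0: "quadric a b c d e f (g 1 s t) (g 2 s t) (g 3 s t) = 0" for s t
    unfolding q(2) by (rule trans[OF quadric_scale]) (simp only: conic(2) mult_zero_right)
  define D :: "(complex ^ 3) set set"
    where "D = {L \<in> proj_space. \<forall>x\<in>L. quadric a b c d e f (x $ 1) (x $ 2) (x $ 3) = 0}"
  have "plane_conic D"
    unfolding plane_conic_def D_def by (intro exI conjI, rule conic(1), rule refl)
  moreover have "proj_map M L \<in> D" if LC: "L \<in> C" "proj_map M L \<noteq> {0}" for L
  proof -
    let ?v = "M *v (A *v veronese (\<sigma> L) (\<tau> L))"
    have eq: "proj_map M L = vec.span {?v}"
      using arg_cong[OF L[OF LC(1)], of "proj_map M"] unfolding proj_map_span .
    have "?v \<noteq> 0"
    proof
      assume zero: "?v = 0"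
      show False
        using LC(2) unfolding eq zero by simp
    qed
    then show ?thesis
      unfolding eq D_def span_mem_conic_iff[OF \<open>?v \<noteq> 0\<close>] using g0[of "\<sigma> L" "\<tau> L"]
      by (simp add: g_def)
  qed
  ultimately show ?thesis
    by blast
qed

subsection \<open>Rational normal curves from conics\<close>

lemma matrix_columns_mult:
  "(\<chi> a b. w b $ a) *v x = (\<Sum>b\<in>UNIV. x $ b *s (w b :: complex ^ 'n))"
  by (simp add: matrix_mult_sum column_def)

text \<open>Independence concerns only the set of columns; injectivity ensures that this set has
  \<open>CARD('n)\<close> elements and hence spans.\<close>

lemma matrix_columns_invertible:
  fixes w :: "'n \<Rightarrow> complex ^ 'n"
  assumes "vec.independent (range w)" and "inj w"
  shows "invertible (\<chi> a b. w b $ a)"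
proof -
  have "UNIV \<subseteq> vec.span (range w)"
  proof (rule vec.card_ge_dim_independent)
    show "vec.dim (UNIV :: (complex ^ 'n) set) \<le> card (range w)"
      using assms(2) unfolding vec_dim_card by (simp add: card_image)
  qed (use assms(1) in auto)
  moreover have "columns (\<chi> a b. w b $ a) = range w"
    unfolding columns_def column_def by auto
  ultimately show ?thesis
    unfolding invertible_right_inverse matrix_right_invertible_span_columns by auto
qed

lemma matrix_columns_mult_in_span:
  fixes w :: "'n \<Rightarrow> complex ^ 'n"
  assumes "\<And>i. i \<notin> J \<Longrightarrow> x $ i = 0"
  shows "(\<chi> a b. w b $ a) *v x \<in> vec.span (w ` J)"
proof -
  have "x $ b *s w b \<in> vec.span (w ` J)" for b
  proof (cases "b \<in> J")
    case True
    then show ?thesis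
      by (intro vec.span_scale vec.span_base) auto
  next
    case False
    then show ?thesis
      by (simp add: assms vec.span_zero)
  qed
  then show ?thesis
    unfolding matrix_columns_mult by (intro vec.span_sum)
qed

text \<open>The coordinates are forms of degree one less than \<open>CARD('n)\<close>, so the curve
  is a matrix \<open>B\<close> applied to the Veronese curve. As in Lagrange interpolation, at the
  zero of one linear form only the product omitting it survives; hence the products are independent
  and \<open>B\<close> is invertible.\<close>

lemma rational_normal_curve_of_linear_forms:
  fixes W :: "complex ^ 'n ^ 'n" and l m :: "'n \<Rightarrow> complex"
  assumes W: "invertible W"
    and neq: "\<And>i j. i \<noteq> j \<Longrightarrow> l i * m j \<noteq> m i * l j"
  shows "\<exists>C. rational_normal_curve C \<and> (\<forall>s t. (s, t) \<noteq> (0, 0) \<longrightarrow>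
    vec.span {W *v (\<chi> i. \<Prod>j\<in>-{i}. l j * s + m j * t)} \<in> C)"
proof -
  define P where "P i s t = (\<Prod>j\<in>-{i}. l j * s + m j * t)" for i s t
  obtain d where d: "CARD('n) = d + 1"
    by (metis Suc_eq_plus1 Suc_pred zero_less_card_finite)
  have "card (-{i}) = d" for i :: 'n
    using d by (simp add: Compl_eq_Diff_UNIV card_Diff_singleton)
  then have "binary_form d (P i)" for i
    unfolding P_def using binary_form_prod_linear[of "-{i}" l m] by simp
  then have "\<forall>i. \<exists>c :: complex ^ 'n. \<forall>s t. P i s t = (\<Sum>k\<in>UNIV. c $ k * veronese s t $ k)"
    unfolding binary_form_iff_veronese[OF d] by blast
  then obtain c :: "'n \<Rightarrow> complex ^ 'n"
    where c: "\<And>i s t. P i s t = (\<Sum>k\<in>UNIV. c i $ k * veronese s t $ k)"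
    using choice[of "\<lambda>i c. \<forall>s t. P i s t = (\<Sum>k\<in>UNIV. c $ k * veronese s t $ k)"] by blast
  define B where "B = (\<chi> i. c i)"
  have B: "B *v veronese s t = (\<chi> i. P i s t)" for s t
    unfolding vec_eq_iff B_def matrix_vector_mult_def c by simp
  have "e i = 0" if e: "(\<Sum>i\<in>UNIV. e i *s row i B) = 0" for e i
  proof -
    have "(\<Sum>j\<in>UNIV. e j * P j s t) = 0" for s t
    proof -
      have "(\<Sum>j\<in>UNIV. e j * P j s t)
          = (\<Sum>j\<in>UNIV. \<Sum>k\<in>UNIV. e j * (c j $ k * veronese s t $ k))"
        unfolding c sum_distrib_left ..
      also have "\<dots> = (\<Sum>k\<in>UNIV. \<Sum>j\<in>UNIV. e j * (c j $ k * veronese s t $ k))"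
        by (rule sum.swap)
      also have "\<dots> = (\<Sum>k\<in>UNIV. (\<Sum>j\<in>UNIV. e j *s row j B) $ k * veronese s t $ k)"
        unfolding B_def row_def by (simp add: sum_distrib_right mult.assoc)
      finally show ?thesis
        unfolding e by simp
    qed
    \<comment> \<open>\<open>(m i, - l i)\<close> is the zero of the \<open>i\<close>-th linear
      form, which is a factor of every other product.\<close>
    moreover have "P j (m i) (- l i) = 0" if "j \<noteq> i" for j
      unfolding P_def using that by (intro prod_zero bexI[of _ i]) auto
    then have "(\<Sum>j\<in>UNIV. e j * P j (m i) (- l i)) = e i * P i (m i) (- l i)"
      by (subst sum.remove[of _ i]) (auto intro!: sum.neutral)
    ultimately have "e i * P i (m i) (- l i) = 0"
      by metis
    moreover have "P i (m i) (- l i) \<noteq> 0"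
      unfolding P_def using neq[of _ i] by (auto simp: mult.commute)
    ultimately show ?thesis
      by simp
  qed
  then have "invertible B"
    unfolding invertible_right_inverse matrix_right_invertible_independent_rows by blast
  then have "invertible (W ** B)"
    using W by (rule invertible_mult[rotated])
  then have "rational_normal_curve (proj_map (W ** B) ` standard_rational_normal_curve)"
    unfolding rational_normal_curve_def by blast
  moreover have "vec.span {W *v (\<chi> i. P i s t)} \<in> proj_map (W ** B) ` standard_rational_normal_curve"
    if "(s, t) \<noteq> (0, 0)" for s t
  proof
    show "vec.span {W *v (\<chi> i. P i s t)} = proj_map (W ** B) (vec.span {veronese s t})"
      unfolding proj_map_span matrix_vector_mul_assoc[symmetric] B ..
    show "vec.span {veronese s t} \<in> standard_rational_normal_curve"
      unfolding standard_rational_normal_curve_def using that by blast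
  qed
  ultimately show ?thesis
    unfolding P_def by blast
qed

text \<open>In coordinates with respect to \<open>u\<close>, \<open>v\<close>, \<open>w\<close> the
  coefficients of the squares are the values of the quadratic form at these vectors, which are 0.
  The mixed coefficients cannot all vanish, because the vectors span the space and the form is
  nonzero.\<close>

lemma conic_through_basis_points:
  fixes u v w :: "complex ^ 3"
  assumes C: "plane_conic C"
    and gen: "\<And>y. \<exists>a b c. y = a *s u + b *s v + c *s w"
    and mem: "vec.span {u} \<in> C" "vec.span {v} \<in> C" "vec.span {w} \<in> C"
  shows "\<exists>\<alpha> \<beta> \<gamma>. (\<alpha>, \<beta>, \<gamma>) \<noteq> (0, 0, 0) \<and>
    (\<forall>x y z. vec.span {x *s u + y *s v + z *s w} \<in> C \<longrightarrow>
      \<alpha> * (x * y) + \<beta> * (x * z) + \<gamma> * (y * z) = 0)"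
proof -
  obtain a b c d e f where nz: "(a, b, c, d, e, f) \<noteq> (0, 0, 0, 0, 0, 0)"
    and C_eq: "C = {L \<in> proj_space. \<forall>x\<in>L. quadric a b c d e f (x $ 1) (x $ 2) (x $ 3) = 0}"
    using C unfolding plane_conic_def by (elim exE conjE)
  define q where "q y = quadric a b c d e f (y $ 1) (y $ 2) (y $ 3)" for y :: "complex ^ 3"
  have q0: "q y = 0" if "vec.span {y} \<in> C" for y
    using that vec.span_base[of y "{y}"] unfolding C_eq q_def by auto
  \<comment> \<open>The polar bilinear form of \<open>q\<close>: \<open>h y z\<close> equals
    \<open>q (y + z) - q y - q z\<close>.\<close>
  define h where "h y z = 2 * a * y $ 1 * z $ 1 + 2 * b * y $ 2 * z $ 2 + 2 * c * y $ 3 * z $ 3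
    + d * (y $ 1 * z $ 2 + y $ 2 * z $ 1) + e * (y $ 1 * z $ 3 + y $ 3 * z $ 1)
    + f * (y $ 2 * z $ 3 + y $ 3 * z $ 2)" for y z :: "complex ^ 3"
  have expand: "q (x *s u + y *s v + z *s w) =
      h u v * (x * y) + h u w * (x * z) + h v w * (y * z)" for x y z
  proof -
    have "q (x *s u + y *s v + z *s w) = x\<^sup>2 * q u + y\<^sup>2 * q v + z\<^sup>2 * q w
        + h u v * (x * y) + h u w * (x * z) + h v w * (y * z)"
      unfolding q_def h_def vector_add_component vector_smult_component by algebra
    then show ?thesis
      using mem q0 by simp
  qed
  have "(h u v, h u w, h v w) \<noteq> (0, 0, 0)"
  proof
    assume "(h u v, h u w, h v w) = (0, 0, 0)"
    then have zero: "q y = 0" for y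
      using gen[of y] expand by auto
    \<comment> \<open>Values at the unit vectors and at their pairwise sums determine all six
      coefficients.\<close>
    have "q (vector [1, 0, 0]) = a" "q (vector [0, 1, 0]) = b" "q (vector [0, 0, 1]) = c"
      "q (vector [1, 1, 0]) = a + b + d" "q (vector [1, 0, 1]) = a + c + e"
      "q (vector [0, 1, 1]) = b + c + f"
      unfolding q_def by simp_all
    then show False
      using nz unfolding zero by simp
  qed
  moreover have "h u v * (x * y) + h u w * (x * z) + h v w * (y * z) = 0"
    if "vec.span {x *s u + y *s v + z *s w} \<in> C" for x y z
    using q0[OF that] unfolding expand .
  ultimately show ?thesis
    by (intro exI conjI allI impI)
qed

text \<open>Dividing the \<open>i\<close>-th equation by the product of the coordinates
  \<open>i\<close>, \<open>i1\<close>, \<open>i2\<close> gives a linear relation among the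
  reciprocals, which is solved for the \<open>i\<close>-th one. The resulting linear forms in two
  variables define the curve.\<close>

lemma rational_normal_curve_of_conics:
  fixes W :: "complex ^ 'n ^ 'n" and x :: "'a \<Rightarrow> complex ^ 'n"
  assumes W: "invertible W" and i12: "i1 \<noteq> i2"
    and nz: "\<And>k i. k \<in> K \<Longrightarrow> x k $ i \<noteq> 0"
    and k12: "k1 \<in> K" "k2 \<in> K"
    and ratio: "\<And>i j. i \<noteq> j \<Longrightarrow> x k1 $ i * x k2 $ j \<noteq> x k1 $ j * x k2 $ i"
    and conics: "\<And>i. i \<noteq> i1 \<Longrightarrow> i \<noteq> i2 \<Longrightarrow> \<exists>\<alpha> \<beta> \<gamma>. (\<alpha>, \<beta>, \<gamma>) \<noteq> (0, 0, 0) \<and>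
      (\<forall>k\<in>K. \<alpha> * (x k $ i * x k $ i1) + \<beta> * (x k $ i * x k $ i2) + \<gamma> * (x k $ i1 * x k $ i2) = 0)"
  shows "\<exists>C. rational_normal_curve C \<and> (\<forall>i. vec.span {W *v axis i 1} \<in> C) \<and>
    (\<forall>k\<in>K. vec.span {W *v x k} \<in> C)"
proof -
  have "\<exists>lm. \<forall>k\<in>K. 1 / x k $ i = fst lm * (1 / x k $ i1) + snd lm * (1 / x k $ i2)" for i
  proof (cases "i = i1 \<or> i = i2")
    case True
    then show ?thesis
    proof
      assume "i = i1"
      then show ?thesis
        by (intro exI[of _ "(1, 0)"]) simp
    next
      assume "i = i2"
      then show ?thesis
        by (intro exI[of _ "(0, 1)"]) simp
    qed
  next
    case False
    then obtain \<alpha> \<beta> \<gamma> where abc: "(\<alpha>, \<beta>, \<gamma>) \<noteq> (0, 0, 0)"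
      and eq: "\<And>k. k \<in> K \<Longrightarrow>
        \<alpha> * (x k $ i * x k $ i1) + \<beta> * (x k $ i * x k $ i2) + \<gamma> * (x k $ i1 * x k $ i2) = 0"
      using conics[of i] by blast
    \<comment> \<open>Otherwise \<open>(\<alpha>, \<beta>)\<close> would solve two homogeneous
      linear equations, from \<open>k1\<close> and \<open>k2\<close>, whose determinant is nonzero
      by \<open>ratio\<close>.\<close>
    have "\<gamma> \<noteq> 0"
    proof
      assume \<gamma>: "\<gamma> = 0"
      have lin: "\<alpha> * x k $ i1 + \<beta> * x k $ i2 = 0" if "k \<in> K" for k
      proof -
        have "x k $ i * (\<alpha> * x k $ i1 + \<beta> * x k $ i2) = 0"
          using eq[OF that] \<gamma> by (simp add: algebra_simps)
        then show ?thesis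
          using nz[OF that] by simp
      qed
      have "\<alpha> * (x k1 $ i1 * x k2 $ i2 - x k1 $ i2 * x k2 $ i1) = 0"
        using lin[OF k12(1)] lin[OF k12(2)] by algebra
      moreover have "\<beta> * (x k1 $ i1 * x k2 $ i2 - x k1 $ i2 * x k2 $ i1) = 0"
        using lin[OF k12(1)] lin[OF k12(2)] by algebra
      ultimately show False
        using abc \<gamma> ratio[OF i12] by simp
    qed
    have "1 / x k $ i = - \<beta> / \<gamma> * (1 / x k $ i1) + - \<alpha> / \<gamma> * (1 / x k $ i2)" if "k \<in> K" for k
    proof -
      have "\<gamma> * (x k $ i1 * x k $ i2) = - (\<beta> * (x k $ i * x k $ i2)) - \<alpha> * (x k $ i * x k $ i1)"
        using eq[OF that] by algebra
      then show ?thesis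
        using \<open>\<gamma> \<noteq> 0\<close> nz[OF that, of i] nz[OF that, of i1] nz[OF that, of i2]
        by (simp add: divide_simps) algebra
    qed
    then show ?thesis
      by (intro exI[of _ "(- \<beta> / \<gamma>, - \<alpha> / \<gamma>)"]) simp
  qed
  then obtain lm where
    lm: "\<And>i k. k \<in> K \<Longrightarrow> 1 / x k $ i = fst (lm i) * (1 / x k $ i1) + snd (lm i) * (1 / x k $ i2)"
    by metis
  define l m where "l i = fst (lm i)" and "m i = snd (lm i)" for i
  have inv: "l i * (1 / x k $ i1) + m i * (1 / x k $ i2) = 1 / x k $ i" if "k \<in> K" for i k
    unfolding l_def m_def using lm[OF that, of i] by simp
  \<comment> \<open>If two of the linear forms were proportional, the reciprocals of the coordinates
    \<open>i\<close> and \<open>j\<close> at \<open>k1\<close> and \<open>k2\<close> would have zero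
    determinant, contrary to \<open>ratio\<close>.\<close>
  have neq: "l i * m j \<noteq> m i * l j" if "i \<noteq> j" for i j
  proof
    assume "l i * m j = m i * l j"
    then have "(l i * (1 / x k1 $ i1) + m i * (1 / x k1 $ i2)) *
        (l j * (1 / x k2 $ i1) + m j * (1 / x k2 $ i2)) =
      (l j * (1 / x k1 $ i1) + m j * (1 / x k1 $ i2)) *
        (l i * (1 / x k2 $ i1) + m i * (1 / x k2 $ i2))"
      by algebra
    then have "x k1 $ j * x k2 $ i = x k1 $ i * x k2 $ j"
      unfolding inv[OF k12(1)] inv[OF k12(2)] using nz[OF k12(1)] nz[OF k12(2)]
      by (simp add: field_simps)
    with ratio[OF that] show False
      by simp
  qed
  obtain C where C: "rational_normal_curve C"
    "\<And>s t. (s, t) \<noteq> (0, 0) \<Longrightarrow> vec.span {W *v (\<chi> i. \<Prod>j\<in>-{i}. l j * s + m j * t)} \<in> C"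
    using rational_normal_curve_of_linear_forms[of W l m, OF W neq] by blast
  \<comment> \<open>A point lies on the curve once its coordinates agree with a curve vector up to a
    nonzero factor \<open>D\<close>.\<close>
  have mem: "vec.span {W *v y} \<in> C"
    if "(s, t) \<noteq> (0, 0)" "D \<noteq> 0" "\<And>i. (\<Prod>j\<in>-{i}. l j * s + m j * t) = D * y $ i" for s t D y
  proof -
    have "(\<chi> i. \<Prod>j\<in>-{i}. l j * s + m j * t) = D *s y"
      unfolding vec_eq_iff using that(3) by simp
    then show ?thesis
      using C(2)[OF that(1)] that(2) by (simp add: vector_scalar_commute span_singleton_scale)
  qed
  have "vec.span {W *v axis i 1} \<in> C" for i
  proof (rule mem)
    \<comment> \<open>The \<open>i\<close>-th linear form is not zero, since it is not proportional
      to that of \<open>i1\<close> or of \<open>i2\<close>, whichever index differs from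
      \<open>i\<close>.\<close>
    show "(m i, - l i) \<noteq> (0, 0)"
      using neq[of i i1] neq[of i i2] i12 by (cases "i = i1") auto
    show "(\<Prod>j\<in>-{i}. l j * m i + m j * - l i) \<noteq> 0"
      using neq[of _ i] by auto
    show "(\<Prod>j\<in>-{k}. l j * m i + m j * - l i) =
        (\<Prod>j\<in>-{i}. l j * m i + m j * - l i) * axis i 1 $ k" for k
    proof (cases "k = i")
      case False
      then have "(\<Prod>j\<in>-{k}. l j * m i + m j * - l i) = 0"
        by (intro prod_zero bexI[of _ i]) auto
      with False show ?thesis
        by (simp add: axis_def)
    qed simp
  qed
  \<comment> \<open>At the parameter formed by the two reciprocals, the \<open>j\<close>-th linear
    form takes the value \<open>1 / x k $ j\<close>. Omitting the \<open>i\<close>-th factor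
    multiplies the full product \<open>D\<close> by \<open>x k $ i\<close>.\<close>
  moreover have "vec.span {W *v x k} \<in> C" if k: "k \<in> K" for k
  proof (rule mem)
    show "(1 / x k $ i1, 1 / x k $ i2) \<noteq> (0, 0)"
      using nz[OF k] by simp
    show "(\<Prod>j\<in>UNIV. 1 / x k $ j) \<noteq> 0"
      using nz[OF k] by simp
    show "(\<Prod>j\<in>-{i}. l j * (1 / x k $ i1) + m j * (1 / x k $ i2)) =
        (\<Prod>j\<in>UNIV. 1 / x k $ j) * x k $ i" for i
    proof -
      have "(\<Prod>j\<in>UNIV. 1 / x k $ j) = 1 / x k $ i * (\<Prod>j\<in>-{i}. 1 / x k $ j)"
        unfolding Compl_eq_Diff_UNIV by (rule prod.remove) auto
      then show ?thesis
        unfolding inv[OF k] using nz[OF k, of i] by simp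
    qed
  qed
  ultimately show ?thesis
    using C(1) by blast
qed

subsection \<open>Points in general position\<close>

lemma span_Union_points:
  fixes r :: "(complex ^ 'n) set \<Rightarrow> complex ^ 'n"
  assumes "\<And>L. L \<in> S \<Longrightarrow> L = vec.span {r L}"
  shows "vec.span (\<Union>S) = vec.span (r ` S)"
proof -
  have "\<Union>S \<subseteq> vec.span (r ` S)"
  proof
    fix x assume "x \<in> \<Union>S"
    then obtain L where L: "L \<in> S" "x \<in> L"
      by blast
    then have "x \<in> vec.span {r L}"
      using assms[of L] by blast
    then show "x \<in> vec.span (r ` S)"
      using L(1) vec.span_mono[of "{r L}" "r ` S"] by blast
  qed
  moreover have "r ` S \<subseteq> vec.span (\<Union>S)"
  proof
    fix y assume "y \<in> r ` S"
    then obtain L where L: "L \<in> S" "y = r L"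
      by blast
    have "r L \<in> vec.span {r L}"
      by (rule vec.span_base) simp
    then have "r L \<in> L"
      using assms[OF L(1)] by blast
    then show "y \<in> vec.span (\<Union>S)"
      using L by (intro vec.span_base) blast
  qed
  ultimately show ?thesis
    unfolding vec.span_eq ..
qed

text \<open>General position speaks only of sets of \<open>CARD('n)\<close> points, so
  \<open>S\<close> is first enlarged to such a set. Its representatives span, and by their number
  they form a basis.\<close>

lemma general_position_independent:
  fixes \<Gamma> :: "(complex ^ 'n) set set"
  assumes "general_position \<Gamma>" "finite \<Gamma>" "CARD('n) \<le> card \<Gamma>"
    and r: "\<And>L. L \<in> \<Gamma> \<Longrightarrow> L = vec.span {r L}"
    and S: "S \<subseteq> \<Gamma>" "card S \<le> CARD('n)"
  shows "inj_on r S" and "vec.independent (r ` S)"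
proof -
  obtain T where T: "S \<subseteq> T" "T \<subseteq> \<Gamma>" "card T = CARD('n)"
    using exists_subset_between[OF S(2) assms(3) S(1) assms(2)] by blast
  have fin: "finite T"
    using T(2) assms(2) finite_subset by blast
  have "vec.span (\<Union>T) = UNIV"
    using assms(1) T unfolding general_position_def proj_span_def by blast
  moreover have "vec.span (\<Union>T) = vec.span (r ` T)"
    by (rule span_Union_points, rule r) (use T(2) in blast)
  ultimately have span: "vec.span (r ` T) = UNIV"
    by simp
  have "CARD('n) \<le> card (r ` T)"
    using vec.dim_le_card[of UNIV "r ` T"] span fin unfolding vec_dim_card by simp
  then have card: "card (r ` T) = CARD('n)"
    using card_image_le[OF fin, of r] T(3) by simp
  then have "inj_on r T"
    using T(3) fin by (simp add: eq_card_imp_inj_on)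
  then show "inj_on r S"
    using T(1) inj_on_subset by blast
  have "vec.independent (r ` T)"
  proof (rule vec.card_le_dim_spanning)
    show "card (r ` T) \<le> vec.dim (UNIV :: (complex ^ 'n) set)"
      unfolding vec_dim_card card ..
  qed (use span fin in auto)
  then show "vec.independent (r ` S)"
    using T(1) vec.independent_mono by blast
qed

text \<open>In the main proof this excludes points from the projection centres and makes coordinates
  and 2 by 2 minors nonzero.\<close>

lemma general_position_not_in_span:
  fixes \<Gamma> :: "(complex ^ 'n) set set"
  assumes "general_position \<Gamma>" "finite \<Gamma>" "CARD('n) \<le> card \<Gamma>"
    and "\<And>L. L \<in> \<Gamma> \<Longrightarrow> L = vec.span {r L}"
    and "L \<in> \<Gamma>" "S \<subseteq> \<Gamma>" "L \<notin> S" "card S < CARD('n)"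
  shows "r L \<notin> vec.span (r ` S)"
proof -
  have "finite S"
    using assms(2,6) finite_subset by blast
  then have S: "insert L S \<subseteq> \<Gamma>" "card (insert L S) \<le> CARD('n)"
    using assms(5-8) by auto
  have "inj_on r (insert L S)" "vec.independent (insert (r L) (r ` S))"
    using general_position_independent[OF assms(1-4) S] by auto
  moreover from this(1) have "r L \<notin> r ` S"
    using assms(7) by auto
  ultimately show ?thesis
    by (simp add: vec.independent_insert)
qed

section \<open>The two directions of the equivalence\<close>

theorem corollary4:
  fixes d :: nat
    and \<Gamma> U :: "(complex ^ 'n) set set"
    and \<pi> :: "(complex ^ 'n) set \<Rightarrow> (complex ^ 'n) set \<Rightarrow> (complex ^ 3) set"
  assumes "d \<ge> 2" and "CARD('n) = d + 1"
    and "\<Gamma> \<subseteq> proj_space" and "card \<Gamma> = d + 4" and "general_position \<Gamma>"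
    and "U \<subseteq> \<Gamma>" and "card U = d - 1"
    and "\<And>p. p \<in> U \<Longrightarrow> projection_from (proj_span (U - {p})) (\<pi> p)"
  shows "(\<exists>C. rational_normal_curve C \<and> \<Gamma> \<subseteq> C) \<longleftrightarrow>
         (\<forall>p\<in>U. \<exists>C. plane_conic C \<and> insert (\<pi> p p) (\<pi> p ` (\<Gamma> - U)) \<subseteq> C)"
proof -
  have fin: "finite \<Gamma>"
    using assms(4) by (intro card_ge_0_finite) simp
  then have finU: "finite U"
    using assms(6) finite_subset by blast
  have "\<forall>L\<in>\<Gamma>. \<exists>v. L = vec.span {v}"
    using assms(3) unfolding proj_space_def by blast
  then obtain r where "\<forall>L\<in>\<Gamma>. L = vec.span {r L}"
    by (rule bchoice[THEN exE])
  then have r: "L = vec.span {r L}" if "L \<in> \<Gamma>" for L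
    using that by (rule bspec)
  have not_in_span: "r L \<notin> vec.span (r ` S)"
    if "L \<in> \<Gamma>" "S \<subseteq> \<Gamma>" "L \<notin> S" "card S < d + 1" for L S
    using general_position_not_in_span[OF assms(5) fin _ r that(1-3)] that(4) assms(2,4) by simp
  have proj_span_r: "proj_span S = vec.span (r ` S)" if "S \<subseteq> \<Gamma>" for S
    unfolding proj_span_def by (rule span_Union_points, rule r) (use that in blast)
  have M_ex: "\<exists>M :: complex ^ 'n ^ 3. surj ((*v) M) \<and> {v. M *v v = 0} = vec.span (r ` (U - {p}))
      \<and> \<pi> p = proj_map M" if "p \<in> U" for p
  proof -
    have "U - {p} \<subseteq> \<Gamma>"
      using assms(6) by blast
    then show ?thesis
      using assms(8)[OF that] unfolding projection_from_def by (simp only: proj_span_r)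
  qed
  have proj: "proj_map M L = vec.span {M *v r L}" if "L \<in> \<Gamma>" for M :: "complex ^ 'n ^ 3" and L
    using arg_cong[OF r[OF that], of "proj_map M"] unfolding proj_map_span .
  show ?thesis
  proof
    assume "\<exists>C. rational_normal_curve C \<and> \<Gamma> \<subseteq> C"
    then obtain C where C: "rational_normal_curve C" "\<Gamma> \<subseteq> C"
      by blast
    show "\<forall>p\<in>U. \<exists>C. plane_conic C \<and> insert (\<pi> p p) (\<pi> p ` (\<Gamma> - U)) \<subseteq> C"
    proof
      fix p assume p: "p \<in> U"
      obtain M :: "complex ^ 'n ^ 3" where M: "{v. M *v v = 0} = vec.span (r ` (U - {p}))"
        "\<pi> p = proj_map M"
        using M_ex[OF p] by blast
      have card: "card (U - {p}) = d - 2"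
        using p assms(7) finU by simp
      have "proj_map M L = {0}" if "L \<in> U - {p}" for L
      proof -
        have "r L \<in> vec.span (r ` (U - {p}))"
          using that by (intro vec.span_base imageI)
        then have "M *v r L = 0"
          using M(1) by blast
        moreover have "L \<in> \<Gamma>"
          using that assms(6) by blast
        ultimately show ?thesis
          using proj[of L M] by simp
      qed
      then obtain D where D: "plane_conic D"
        "\<And>L. L \<in> C \<Longrightarrow> proj_map M L \<noteq> {0} \<Longrightarrow> proj_map M L \<in> D"
        using plane_conic_of_rational_normal_curve[OF assms(1,2) C(1), of "U - {p}" M]
          C(2) assms(6) finU card by blast
      \<comment> \<open>The centre is spanned by only \<open>d - 2\<close> points of
        \<open>\<Gamma>\<close> other than \<open>L\<close>, so \<open>L\<close> has a genuine image
        point.\<close>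
      have "proj_map M L \<in> D" if L: "L \<in> insert p (\<Gamma> - U)" for L
      proof (rule D(2))
        have "L \<in> \<Gamma>"
          using L p assms(6) by blast
        then show "L \<in> C"
          using C(2) by blast
        have "r L \<notin> vec.span (r ` (U - {p}))"
        proof (rule not_in_span[OF \<open>L \<in> \<Gamma>\<close>])
          show "card (U - {p}) < d + 1"
            unfolding card by simp
        qed (use L assms(6) in auto)
        then have "M *v r L \<noteq> 0"
          using M(1) by blast
        then show "proj_map M L \<noteq> {0}"
          unfolding proj[OF \<open>L \<in> \<Gamma>\<close>] using vec.span_base[of "M *v r L" "{M *v r L}"] by auto
      qed
      then have "insert (\<pi> p p) (\<pi> p ` (\<Gamma> - U)) \<subseteq> D"
        unfolding M(2) by blast
      with D(1) show "\<exists>C. plane_conic C \<and> insert (\<pi> p p) (\<pi> p ` (\<Gamma> - U)) \<subseteq> C"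
        by (intro exI[of _ D] conjI)
    qed
  next
    assume conics: "\<forall>p\<in>U. \<exists>C. plane_conic C \<and> insert (\<pi> p p) (\<pi> p ` (\<Gamma> - U)) \<subseteq> C"
    have "card (\<Gamma> - U) = 5"
      using assms(1,4,6,7) finU by (simp add: card_Diff_subset)
    then obtain Q where Q: "Q \<subseteq> \<Gamma> - U" "card Q = 2"
      using obtain_subset_with_card_n[of 2 "\<Gamma> - U"] by auto
    then obtain q1 q2 where q: "Q = {q1, q2}" "q1 \<noteq> q2"
      unfolding card_2_iff by blast
    \<comment> \<open>\<open>U\<close> and two further points form a basis of coordinate points;
      three points, collected in \<open>K\<close>, remain.\<close>
    define B where "B = U \<union> Q"
    have finQ: "finite Q"
      using q by simp
    have B: "B \<subseteq> \<Gamma>" "finite B"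
      unfolding B_def using Q(1) assms(6) finU finQ by auto
    have "U \<inter> Q = {}"
      using Q(1) by blast
    then have cardB: "card B = d + 1"
      unfolding B_def using card_Un_disjoint[OF finU finQ] Q(2) assms(1,7) by simp
    define K where "K = \<Gamma> - B"
    have K: "K \<subseteq> \<Gamma>" "K \<inter> B = {}" "K \<subseteq> \<Gamma> - U"
      unfolding K_def B_def by auto
    have "card K = 3"
      unfolding K_def using B assms(4) cardB by (simp add: card_Diff_subset)
    then obtain K' where "K' \<subseteq> K" "card K' = 2"
      using obtain_subset_with_card_n[of 2 K] by auto
    then obtain k1 k2 where k12: "k1 \<in> K" "k2 \<in> K" "k1 \<noteq> k2"
      unfolding card_2_iff by blast
    obtain \<phi> :: "'n \<Rightarrow> (complex ^ 'n) set" where \<phi>: "bij_betw \<phi> UNIV B"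
      using finite_same_card_bij[of "UNIV :: 'n set" B] B(2) cardB assms(2) by auto
    have range_\<phi>: "range \<phi> = B"
      using \<phi> by (simp add: bij_betw_def)
    have \<phi>_inj: "\<phi> i = \<phi> j \<longleftrightarrow> i = j" for i j
      using inj_eq[of \<phi>] \<phi> by (simp add: bij_betw_def)
    have \<phi>_mem: "\<phi> i \<in> B" for i
      unfolding range_\<phi>[symmetric] by (rule rangeI)
    have \<phi>_image: "\<phi> ` (-J) = B - \<phi> ` J" for J
      unfolding Compl_eq_Diff_UNIV range_\<phi>[symmetric]
      by (rule image_set_diff) (use \<phi> in \<open>simp add: bij_betw_def\<close>)
    have "q1 \<in> range \<phi>" "q2 \<in> range \<phi>"
      unfolding range_\<phi> B_def q(1) by simp_all
    then obtain i1 i2 where i12: "\<phi> i1 = q1" "\<phi> i2 = q2"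
      by blast
    then have i12_neq: "i1 \<noteq> i2"
      using q(2) by blast
    define w where "w i = r (\<phi> i)" for i
    define W where "W = (\<chi> a b. w b $ a)"
    have w_image: "w ` J = r ` \<phi> ` J" for J
      unfolding w_def by (simp add: image_image)
    have indep: "inj_on r B" "vec.independent (r ` B)"
      using general_position_independent[OF assms(5) fin _ r B(1)] assms(2,4) cardB by simp_all
    have "inj w"
    proof (rule injI)
      fix i j assume "w i = w j"
      then have "\<phi> i = \<phi> j"
        unfolding w_def using inj_onD[OF indep(1)] \<phi>_mem by blast
      then show "i = j"
        by (simp only: \<phi>_inj)
    qed
    moreover have "vec.independent (range w)"
      unfolding w_image range_\<phi> by (rule indep(2))
    ultimately have W: "invertible W"
      unfolding W_def by (intro matrix_columns_invertible)
    then obtain W' where W': "W ** W' = mat 1"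
      unfolding invertible_def by blast
    define x where "x L = W' *v r L" for L
    have Wx: "W *v x L = r L" for L
      unfolding x_def by (simp add: matrix_vector_mul_assoc W')
    \<comment> \<open>A vector whose coordinates in \<open>J\<close> vanish is spanned by the other
      coordinate points.\<close>
    have in_span: "W *v y \<in> vec.span (r ` (B - \<phi> ` J))" if "\<And>i. i \<in> J \<Longrightarrow> y $ i = 0" for y J
    proof -
      have "W *v y \<in> vec.span (w ` (-J))"
        unfolding W_def by (rule matrix_columns_mult_in_span) (simp add: that)
      then show ?thesis
        by (simp only: w_image \<phi>_image)
    qed
    have nz: "x L $ i \<noteq> 0" if "L \<in> K" for L i
    proof
      assume "x L $ i = 0"
      then have "r L \<in> vec.span (r ` (B - {\<phi> i}))"
        using in_span[of "{i}" "x L"] by (simp add: Wx)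
      moreover have "card (B - {\<phi> i}) < d + 1"
        using \<phi>_mem[of i] B(2) cardB by simp
      ultimately show False
        using not_in_span[of L "B - {\<phi> i}"] that K B(1) by blast
    qed
    have ratio: "x k1 $ i * x k2 $ j \<noteq> x k1 $ j * x k2 $ i" if "i \<noteq> j" for i j
    proof
      assume eq: "x k1 $ i * x k2 $ j = x k1 $ j * x k2 $ i"
      \<comment> \<open>This combination eliminates the coordinate \<open>i\<close>, and by
        \<open>eq\<close> also the coordinate \<open>j\<close>. It puts \<open>k1\<close> into the
        span of \<open>k2\<close> and \<open>d - 1\<close> coordinate points, which are only
        \<open>d\<close> points in all.\<close>
      let ?y = "x k2 $ i *s x k1 - x k1 $ i *s x k2"
      let ?S = "insert k2 (B - {\<phi> i, \<phi> j})"
      have "?y $ a = 0" if "a \<in> {i, j}" for a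
        using that eq by (auto simp: mult.commute)
      then have "W *v ?y \<in> vec.span (r ` (B - {\<phi> i, \<phi> j}))"
        using in_span[of "{i, j}" ?y] by simp
      then have "W *v ?y \<in> vec.span (r ` ?S)"
        using vec.span_mono[of "r ` (B - {\<phi> i, \<phi> j})" "r ` ?S"] by blast
      moreover have "x k1 $ i *s r k2 \<in> vec.span (r ` ?S)"
        by (intro vec.span_scale vec.span_base) simp
      ultimately have "W *v ?y + x k1 $ i *s r k2 \<in> vec.span (r ` ?S)"
        by (rule vec.span_add)
      moreover have "W *v ?y + x k1 $ i *s r k2 = x k2 $ i *s r k1"
        by (simp add: matrix_vector_mult_diff_distrib vector_scalar_commute Wx)
      ultimately have "inverse (x k2 $ i) *s (x k2 $ i *s r k1) \<in> vec.span (r ` ?S)"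
        using vec.span_scale by metis
      then have "r k1 \<in> vec.span (r ` ?S)"
        using nz[OF k12(2), of i] by (simp add: vector_smult_assoc)
      moreover have "card (B - {\<phi> i, \<phi> j}) = d - 1"
        using \<phi>_mem \<phi>_inj that B(2) cardB by (simp add: card_Diff_subset)
      then have "card ?S < d + 1"
        using card_insert_le_m1[of "d" "B - {\<phi> i, \<phi> j}" k2] assms(1) by simp
      moreover have "k1 \<notin> ?S" "k1 \<in> \<Gamma>" "?S \<subseteq> \<Gamma>"
        using k12 K B(1) by auto
      ultimately show False
        using not_in_span[of k1 ?S] by blast
    qed
    have "\<exists>\<alpha> \<beta> \<gamma>. (\<alpha>, \<beta>, \<gamma>) \<noteq> (0, 0, 0) \<and> (\<forall>L\<in>K. \<alpha> * (x L $ i * x L $ i1)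
        + \<beta> * (x L $ i * x L $ i2) + \<gamma> * (x L $ i1 * x L $ i2) = 0)"
      if i: "i \<noteq> i1" "i \<noteq> i2" for i
    proof -
      have "\<phi> i \<noteq> q1" "\<phi> i \<noteq> q2"
        using i i12 \<phi>_inj by auto
      then have p: "\<phi> i \<in> U"
        using \<phi>_mem[of i] q(1) unfolding B_def by blast
      obtain M :: "complex ^ 'n ^ 3" where M: "surj ((*v) M)"
        "{v. M *v v = 0} = vec.span (r ` (U - {\<phi> i}))" "\<pi> (\<phi> i) = proj_map M"
        using M_ex[OF p] by blast
      obtain C where C: "plane_conic C" "insert (\<pi> (\<phi> i) (\<phi> i)) (\<pi> (\<phi> i) ` (\<Gamma> - U)) \<subseteq> C"
        using conics p by blast
      have C_mem: "vec.span {M *v r L} \<in> C" if "L \<in> insert (\<phi> i) (\<Gamma> - U)" for L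
      proof -
        have "L \<in> \<Gamma>"
          using that p assms(6) by blast
        then show ?thesis
          using C(2) that unfolding M(3) by (auto simp: proj)
      qed
      \<comment> \<open>All coordinate points but those of \<open>i\<close>, \<open>i1\<close>,
        \<open>i2\<close> lie in the centre, so the projection depends on three coordinates
        only.\<close>
      have M_zero: "M *v w j = 0" if "j \<notin> {i, i1, i2}" for j
      proof -
        have "\<phi> j \<in> U - {\<phi> i}"
          using that \<phi>_mem[of j] \<phi>_inj i12 unfolding B_def q(1) by blast
        then have "w j \<in> vec.span (r ` (U - {\<phi> i}))"
          unfolding w_def by (intro vec.span_base imageI)
        then show ?thesis
          using M(2) by blast
      qed
      have MW: "M *v (W *v y) = y $ i *s (M *v w i) + y $ i1 *s (M *v w i1) + y $ i2 *s (M *v w i2)" for y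
      proof -
        have "M *v (W *v y) = (\<Sum>j\<in>UNIV. y $ j *s (M *v w j))"
          unfolding W_def matrix_columns_mult
          by (simp add: vec.linear_sum[OF matrix_vector_mul_linear_gen] vector_scalar_commute)
        also have "\<dots> = (\<Sum>j\<in>{i, i1, i2}. y $ j *s (M *v w j))"
          by (rule sum.mono_neutral_right) (auto simp: M_zero)
        finally show ?thesis
          using i i12_neq by (simp add: add.assoc)
      qed
      have gen: "\<exists>a b c. v = a *s (M *v w i) + b *s (M *v w i1) + c *s (M *v w i2)" for v
      proof -
        obtain y where "v = M *v y"
          using M(1) by (rule surjE)
        moreover have "y = W *v (W' *v y)"
          by (simp add: matrix_vector_mul_assoc W')
        ultimately have "v = M *v (W *v (W' *v y))"
          by simp
        then show ?thesis
          unfolding MW by blast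
      qed
      \<comment> \<open>The three coordinate points that survive are \<open>p\<close> itself and
        \<open>q1\<close>, \<open>q2\<close> outside \<open>U\<close>; their images lie on the conic
        by hypothesis.\<close>
      have mem: "vec.span {M *v w i} \<in> C" "vec.span {M *v w i1} \<in> C" "vec.span {M *v w i2} \<in> C"
        unfolding w_def using Q(1) unfolding q(1) by (auto intro!: C_mem simp: i12)
      obtain \<alpha> \<beta> \<gamma> where abc: "(\<alpha>, \<beta>, \<gamma>) \<noteq> (0, 0, 0)"
        "\<And>x y z. vec.span {x *s (M *v w i) + y *s (M *v w i1) + z *s (M *v w i2)} \<in> C \<Longrightarrow>
          \<alpha> * (x * y) + \<beta> * (x * z) + \<gamma> * (y * z) = 0"
        using conic_through_basis_points[OF C(1) gen mem] by blast
      have "\<alpha> * (x L $ i * x L $ i1) + \<beta> * (x L $ i * x L $ i2) + \<gamma> * (x L $ i1 * x L $ i2) = 0"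
        if "L \<in> K" for L
      proof (rule abc(2))
        have "vec.span {M *v r L} \<in> C"
          using that K(3) by (intro C_mem) blast
        then show "vec.span {x L $ i *s (M *v w i) + x L $ i1 *s (M *v w i1) + x L $ i2 *s (M *v w i2)} \<in> C"
          unfolding MW[symmetric] Wx .
      qed
      with abc(1) show ?thesis
        by (intro exI conjI ballI)
    qed
    then obtain C where C: "rational_normal_curve C" "\<And>i. vec.span {W *v axis i 1} \<in> C"
      "\<And>L. L \<in> K \<Longrightarrow> vec.span {W *v x L} \<in> C"
      using rational_normal_curve_of_conics[OF W i12_neq nz k12(1,2) ratio] by blast
    have "L \<in> C" if L: "L \<in> \<Gamma>" for L
    proof (cases "L \<in> B")
      case True
      then obtain i where i: "L = \<phi> i"
        using range_\<phi> by blast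
      have "W *v axis i 1 = r L"
      proof -
        have "W *v axis i 1 = (\<Sum>b\<in>UNIV. if b = i then w b else 0)"
          unfolding W_def matrix_columns_mult by (intro sum.cong refl) (simp add: axis_def)
        then show ?thesis
          by (simp add: i w_def)
      qed
      then show ?thesis
        using C(2)[of i] r[OF L] by simp
    next
      case False
      then have "L \<in> K"
        unfolding K_def using L by blast
      then show ?thesis
        using C(3)[of L] r[OF L] unfolding Wx by simp
    qed
    with C(1) show "\<exists>C. rational_normal_curve C \<and> \<Gamma> \<subseteq> C"
      by blast
  qed
qed

end
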